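(* Let $\mathcal{T}$ be a finite rooted tree with local routing weights at time $t$: every internal node $v$ with children $1,\ldots,b_v$ carries weights $w_{v,1}(t),\ldots,w_{v,b_v}(t)\ge 0$ on the edges to its children, with $\sum_{i=1}^{b_v} w_{v,i}(t)=1$. For each node $u$ let $a_u(t)=\prod_{e\in P(u)} w_e(t)$ be its node mass, where $P(u)$ is the sequence of edges on the path from the root to $u$. Let $C$ and $C'$ be resolution cuts of $\mathcal{T}$ such that $C'$ refines $C$. Then for every $u\in C$, $$a_u(t)=\sum_{\substack{v\in C'\\ v\text{ descendant of }u}} a_v(t).$$
   Context: Setting: $\mathcal{T}$ is a finite rooted tree, whose leaves are called components. At a given time $t$, each internal (selector) node $v$ with children $1,\ldots,b_v$ stores a local weight vector $(w_{v,1}(t),\ldots,w_{v,b_v}(t))$ with nonnegative real entries summing to $1$; the entry $w_{v,i}(t)$ is regarded as the weight $w_e(t)$ of the edge $e$ from $v$ to its $i$-th child. An internal node with exactly one child contains no decision, and its single outgoing edge has weight $1$. No assumption is made on how the weights arise or depend on $t$. Node mass: for any node $u$ (leaf or internal), $a_u(t)=\prod_{e\in P(u)} w_e(t)$, where $P(u)$ is the sequence of edges from the root to $u$; in particular $a_{\mathrm{root}}(t)=1$ (empty product). Resolution cut: a set of nodes of $\mathcal{T}$ that intersects every root-to-leaf path in exactly one node. Descendant: $v$ is a descendant of $u$ if $u$ lies on the path from the root to $v$; a node counts as a descendant of itself. Refinement: a resolution cut $C'$ refines a resolution cut $C$ if every node of $C'$ is a descendant (possibly equal) of some node of $C$. 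*)

theory Defs
  imports Complex_Main "Graph_Theory.Arc_Walk"
begin

text \<open>
  A finite rooted tree, with arcs directed away from the root. Uniqueness is required of arc walks
  rather than of simple paths, so that directed cycles, loops and parallel arcs are all excluded.
\<close>

locale rooted_tree = fin_digraph T for T :: "('a, 'b) pre_digraph" +
  fixes root :: 'a
  assumes root_in_verts: "root \<in> verts T"
    and unique_walk_from_root: "\<And>u. u \<in> verts T \<Longrightarrow> \<exists>!p. awalk root p u"
begin

definition leaves :: "'a set" where
  "leaves = {v \<in> verts T. out_arcs T v = {}}"

definition internal_nodes :: "'a set" where
  "internal_nodes = verts T - leaves"

definition root_path :: "'a \<Rightarrow> 'b list" where
  "root_path u = (THE p. awalk root p u)"

definition root_path_nodes :: "'a \<Rightarrow> 'a set" where
  "root_path_nodes u = set (awalk_verts root (root_path u))"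

definition descendant :: "'a \<Rightarrow> 'a \<Rightarrow> bool" where
  "descendant v u \<longleftrightarrow> v \<in> verts T \<and> u \<in> root_path_nodes v"

text \<open>
  The weight of the arc from a node to its \<open>i\<close>-th child is the \<open>i\<close>-th entry of that node's
  weight vector; the order of the children plays no role.
\<close>

definition local_weights :: "('b \<Rightarrow> real) \<Rightarrow> bool" where
  "local_weights w \<longleftrightarrow>
     (\<forall>v \<in> internal_nodes. (\<forall>e \<in> out_arcs T v. 0 \<le> w e) \<and> (\<Sum>e \<in> out_arcs T v. w e) = 1)"

definition node_mass :: "('b \<Rightarrow> real) \<Rightarrow> 'a \<Rightarrow> real" where
  "node_mass w u = (\<Prod>e \<leftarrow> root_path u. w e)"

definition resolution_cut :: "'a set \<Rightarrow> bool" where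
  "resolution_cut C \<longleftrightarrow> C \<subseteq> verts T \<and> (\<forall>l \<in> leaves. \<exists>!c. c \<in> C \<inter> root_path_nodes l)"

definition refines :: "'a set \<Rightarrow> 'a set \<Rightarrow> bool" where
  "refines C' C \<longleftrightarrow> (\<forall>v \<in> C'. \<exists>u \<in> C. descendant v u)"

end

end

theory Submission
  imports Defs
begin

text \<open>
  The mass of a node is the total mass of the leaves below it: mass is conserved at each internal
  node, because the weights there sum to 1. Since \<open>C'\<close> refines \<open>C\<close>, the leaves
  below \<open>u \<in> C\<close> are partitioned by the unique node of \<open>C'\<close> on their root path, and
  conservation applied to \<open>u\<close> and to these nodes gives the identity.
\<close>

context rooted_tree
begin

lemma awalk_iff_root_path:
  assumes "u \<in> verts T"
  shows "awalk root p u \<longleftrightarrow> p = root_path u"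
  unfolding root_path_def by (metis theI' unique_walk_from_root[OF assms])

lemma awalk_root_path: "u \<in> verts T \<Longrightarrow> awalk root (root_path u) u"
  by (simp add: awalk_iff_root_path)

text \<open>Walks concatenate and the walk from the root is unique. Facts about the shape of the
  tree thereby become equations between lists of arcs.\<close>

lemma root_path_append:
  assumes "awalk u q v"
  shows "root_path v = root_path u @ q"
proof -
  have "u \<in> verts T" "v \<in> verts T"
    using assms by (auto dest: awalk_hd_in_verts awalk_last_in_verts)
  moreover have "awalk root (root_path u @ q) v"
    using assms awalk_root_path[OF \<open>u \<in> verts T\<close>] by (rule awalk_appendI[rotated])
  ultimately show ?thesis
    by (metis awalk_iff_root_path)
qed

text \<open>Splitting the root path of \<open>v\<close> at \<open>u\<close> leaves a walk from
  \<open>u\<close> to \<open>v\<close>. In this form, transitivity is concatenation of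
  walks.\<close>

lemma descendant_iff_awalk: "descendant v u \<longleftrightarrow> (\<exists>q. awalk u q v)"
proof
  assume "descendant v u"
  then show "\<exists>q. awalk u q v"
    unfolding descendant_def root_path_nodes_def
    using awalk_decomp awalk_root_path by blast
next
  assume "\<exists>q. awalk u q v"
  then obtain q where q: "awalk u q v" by blast
  then have "u \<in> verts T" "v \<in> verts T"
    by (auto dest: awalk_hd_in_verts awalk_last_in_verts)
  moreover have "awalk root (root_path u) u" "awalk root (root_path u @ q) v"
    using awalk_root_path[OF \<open>u \<in> verts T\<close>] q by (auto intro: awalk_appendI)
  \<comment> \<open>\<open>u\<close> is on the root path of \<open>v\<close> as the first vertex of
    its final segment \<open>q\<close>.\<close>
  ultimately show "descendant v u"
    unfolding descendant_def root_path_nodes_def root_path_append[OF q]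
    by (metis UnI2 hd_in_awalk_verts(1) q set_awalk_verts_append)
qed

lemma descendant_refl: "u \<in> verts T \<Longrightarrow> descendant u u"
  unfolding descendant_iff_awalk by (meson awalk_Nil_iff)

lemma descendant_trans: "descendant x v \<Longrightarrow> descendant v u \<Longrightarrow> descendant x u"
  unfolding descendant_iff_awalk by (blast intro: awalk_appendI)

lemma awalk_out_arc: "e \<in> out_arcs T u \<Longrightarrow> awalk u [e] (head T e)"
  by (auto simp: arc_implies_awalk)

lemma descendant_head: "e \<in> out_arcs T u \<Longrightarrow> descendant (head T e) u"
  unfolding descendant_iff_awalk using awalk_out_arc by blast

text \<open>Acyclicity, which makes the induction for mass conservation terminate.\<close>

lemma not_descendant_head:
  assumes "e \<in> out_arcs T u"
  shows "\<not> descendant u (head T e)"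
proof
  assume "descendant u (head T e)"
  then obtain q where "awalk (head T e) q u"
    unfolding descendant_iff_awalk by blast
  \<comment> \<open>Going down \<open>e\<close> and back along \<open>q\<close> would give
    \<open>root_path u = root_path u @ [e] @ q\<close>.\<close>
  from root_path_append[OF this] root_path_append[OF awalk_out_arc[OF assms]]
  show False by simp
qed

lemma node_mass_head:
  assumes "e \<in> out_arcs T u"
  shows "node_mass w (head T e) = node_mass w u * w e"
  unfolding node_mass_def root_path_append[OF awalk_out_arc[OF assms]] by simp

definition leaves_below :: "'a \<Rightarrow> 'a set" where
  "leaves_below u = {l \<in> leaves. descendant l u}"

lemma finite_leaves: "finite leaves"
  unfolding leaves_def by simp

lemma finite_leaves_below: "finite (leaves_below u)"
  unfolding leaves_below_def using finite_leaves by simp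

lemma leaves_below_leaf:
  assumes "u \<in> leaves"
  shows "leaves_below u = {u}"
proof -
  have "l = u" if "awalk u q l" for q l
    using that assms by (cases q) (auto simp: leaves_def awalk_simps)
  then show ?thesis
    using assms descendant_refl[of u] unfolding leaves_below_def
    by (auto simp: descendant_iff_awalk leaves_def)
qed

lemma leaves_below_internal:
  assumes "u \<notin> leaves"
  shows "leaves_below u = (\<Union>e\<in>out_arcs T u. leaves_below (head T e))"
proof (rule set_eqI, rule iffI)
  fix l assume "l \<in> leaves_below u"
  then obtain q where l: "l \<in> leaves" and q: "awalk u q l"
    unfolding leaves_below_def descendant_iff_awalk by blast
  \<comment> \<open>An empty \<open>q\<close> would make \<open>u\<close> equal to the leaf
    \<open>l\<close>.\<close>
  with assms obtain e q' where "q = e # q'"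
    by (cases q) (auto simp: awalk_Nil_iff)
  with q have "e \<in> out_arcs T u" "awalk (head T e) q' l"
    by (auto simp: awalk_Cons_iff)
  with l show "l \<in> (\<Union>e\<in>out_arcs T u. leaves_below (head T e))"
    unfolding leaves_below_def descendant_iff_awalk by blast
next
  fix l assume "l \<in> (\<Union>e\<in>out_arcs T u. leaves_below (head T e))"
  then show "l \<in> leaves_below u"
    unfolding leaves_below_def using descendant_head descendant_trans by blast
qed

text \<open>The root path of a common leaf would continue after \<open>root_path u\<close> with both
  \<open>e\<close> and \<open>f\<close>.\<close>

lemma leaves_below_heads_disjoint:
  assumes e: "e \<in> out_arcs T u" and f: "f \<in> out_arcs T u" and "e \<noteq> f"
  shows "leaves_below (head T e) \<inter> leaves_below (head T f) = {}"
proof (rule ccontr)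
  assume "leaves_below (head T e) \<inter> leaves_below (head T f) \<noteq> {}"
  then obtain l p q where "awalk (head T e) p l" "awalk (head T f) q l"
    unfolding leaves_below_def descendant_iff_awalk by blast
  then have "root_path u @ [e] @ p = root_path u @ [f] @ q"
    using root_path_append awalk_out_arc[OF e] awalk_out_arc[OF f] by (metis append_assoc)
  with \<open>e \<noteq> f\<close> show False by simp
qed

text \<open>Induction on the number of descendants: a leaf is the only leaf below itself, and an
  internal node passes all its mass on to its children.\<close>

lemma node_mass_leaves_below:
  assumes w: "local_weights w" and "u \<in> verts T"
  shows "node_mass w u = (\<Sum>l\<in>leaves_below u. node_mass w l)"
  using \<open>u \<in> verts T\<close>
proof (induction "card {v. descendant v u}" arbitrary: u rule: less_induct)
  case less
  show ?case
  proof (cases "u \<in> leaves")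
    case True
    then show ?thesis by (simp add: leaves_below_leaf)
  next
    case False
    have IH: "node_mass w (head T e) = (\<Sum>l\<in>leaves_below (head T e). node_mass w l)"
      if e: "e \<in> out_arcs T u" for e
    proof (rule less.hyps)
      \<comment> \<open>The inclusion is strict because \<open>u\<close> itself is missing on the
        left, by acyclicity.\<close>
      have "{v. descendant v (head T e)} \<subset> {v. descendant v u}"
        using descendant_trans[OF _ descendant_head[OF e]] not_descendant_head[OF e]
          descendant_refl[OF less.prems] by blast
      moreover have "finite {v. descendant v u}"
        by (rule finite_subset[OF _ finite_verts]) (auto simp: descendant_def)
      ultimately show "card {v. descendant v (head T e)} < card {v. descendant v u}"
        by (rule psubset_card_mono[rotated])
    qed (use e in auto)
    \<comment> \<open>The factor 1 is inserted as the sum of the weights at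
      \<open>u\<close>.\<close>
    have "node_mass w u = (\<Sum>e\<in>out_arcs T u. node_mass w u * w e)"
      using w False less.prems
      by (simp add: local_weights_def internal_nodes_def flip: sum_distrib_left)
    also have "\<dots> = (\<Sum>e\<in>out_arcs T u. \<Sum>l\<in>leaves_below (head T e). node_mass w l)"
      by (intro sum.cong refl) (simp add: IH flip: node_mass_head)
    also have "\<dots> = (\<Sum>l\<in>leaves_below u. node_mass w l)"
      unfolding leaves_below_internal[OF False]
      by (rule sum.UNION_disjoint[symmetric])
        (auto simp: finite_leaves_below dest: leaves_below_heads_disjoint)
    finally show ?thesis .
  qed
qed

lemma resolution_cut_unique:
  assumes "resolution_cut C" "l \<in> leaves" "c \<in> C" "d \<in> C" "descendant l c" "descendant l d"
  shows "c = d"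
  using assms unfolding resolution_cut_def descendant_def by blast

text \<open>A priori the node of \<open>C'\<close> on the root path of a leaf below \<open>u\<close>
  could lie strictly above \<open>u\<close>; refinement excludes this.\<close>

lemma leaves_below_refinement:
  assumes C: "resolution_cut C" and C': "resolution_cut C'" and ref: "refines C' C" and u: "u \<in> C"
  shows "leaves_below u = (\<Union>v\<in>{v \<in> C'. descendant v u}. leaves_below v)"
proof (rule set_eqI, rule iffI)
  fix l assume "l \<in> leaves_below u"
  then have l: "l \<in> leaves" and lu: "descendant l u"
    unfolding leaves_below_def by auto
  obtain v where v: "v \<in> C'" and lv: "descendant l v"
    using C' l unfolding resolution_cut_def descendant_def leaves_def by blast
  obtain c where c: "c \<in> C" and vc: "descendant v c"
    using ref v unfolding refines_def by blast
  \<comment> \<open>Both \<open>c\<close> and \<open>u\<close> are nodes of \<open>C\<close> on the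
    root path of \<open>l\<close>, and a cut has only one there.\<close>
  have "c = u"
    using C l c u descendant_trans[OF lv vc] lu by (rule resolution_cut_unique)
  with l v lv vc show "l \<in> (\<Union>v\<in>{v \<in> C'. descendant v u}. leaves_below v)"
    unfolding leaves_below_def by blast
next
  fix l assume "l \<in> (\<Union>v\<in>{v \<in> C'. descendant v u}. leaves_below v)"
  then show "l \<in> leaves_below u"
    unfolding leaves_below_def using descendant_trans by blast
qed

lemma node_mass_refinement:
  assumes w: "local_weights w" and C: "resolution_cut C" and C': "resolution_cut C'"
    and ref: "refines C' C" and u: "u \<in> C"
  shows "node_mass w u = (\<Sum>v\<in>{v \<in> C'. descendant v u}. node_mass w v)"
proof -
  have sub: "C \<subseteq> verts T" "C' \<subseteq> verts T"
    using C C' unfolding resolution_cut_def by auto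
  have fin: "finite {v \<in> C'. descendant v u}"
    using sub finite_subset[OF _ finite_verts] by simp
  have "node_mass w u = (\<Sum>l\<in>leaves_below u. node_mass w l)"
    using w sub u by (blast intro: node_mass_leaves_below)
  also have "\<dots> = (\<Sum>v\<in>{v \<in> C'. descendant v u}. \<Sum>l\<in>leaves_below v. node_mass w l)"
    unfolding leaves_below_refinement[OF C C' ref u]
  proof (rule sum.UNION_disjoint[OF fin])
    \<comment> \<open>A leaf below two nodes of \<open>C'\<close> would have both on its root
      path.\<close>
    show "\<forall>v\<in>{v \<in> C'. descendant v u}. \<forall>x\<in>{v \<in> C'. descendant v u}.
        v \<noteq> x \<longrightarrow> leaves_below v \<inter> leaves_below x = {}"
      using resolution_cut_unique[OF C'] unfolding leaves_below_def by blast
  qed (simp add: finite_leaves_below)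
  also have "\<dots> = (\<Sum>v\<in>{v \<in> C'. descendant v u}. node_mass w v)"
    using sub by (intro sum.cong refl node_mass_leaves_below[OF w, symmetric]) auto
  finally show ?thesis .
qed

end

theorem proposition2:
  fixes T :: "('a, 'b) pre_digraph" and root :: 'a
    and w :: "'t \<Rightarrow> 'b \<Rightarrow> real" and t :: 't
    and C C' :: "'a set"
  assumes "rooted_tree T root"
    and "rooted_tree.local_weights T (w t)"
    and "rooted_tree.resolution_cut T root C"
    and "rooted_tree.resolution_cut T root C'"
    and "rooted_tree.refines T root C' C"
  shows "\<forall>u \<in> C. rooted_tree.node_mass T root (w t) u
           = (\<Sum>v \<in> {v \<in> C'. rooted_tree.descendant T root v u}. rooted_tree.node_mass T root (w t) v)"
  using rooted_tree.node_mass_refinement[OF assms] by blast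

end
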